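(* In the loop-free multigraph game, the Angel has a winning strategy for every starting position; that is, for every finite loop-free multigraph $G$ with a graphical degree sequence, the Angel has a strategy such that, whatever the Devil's choices, she is always able to move and a simple graph is reached after finitely many moves.
   Context: A loop-free multigraph is a finite undirected graph without loops in which several edges may join the same pair of distinct vertices. The type of an edge joining $u$ and $v$ is the unordered pair $\{u,v\}$, and its multiplicity is the number of edges of that type. An edge is simple if its type has multiplicity one, and a multiple edge if its type has multiplicity at least two; a graph is simple if all its edges are simple. The degree sequence is the weakly decreasing list of vertex degrees, and it is graphical if it is the degree sequence of some simple graph. Two edges are incident if they share at least one vertex. Given two distinct edges of types $\{v_1,v_2\}$ and $\{v_3,v_4\}$, the double edge swap $(v_1,v_2)(v_3,v_4)$ removes them and adds edges of types $\{v_2,v_3\}$ and $\{v_4,v_1\}$; a double edge swap on two edges $e,e'$ means any such swap with $e,e'$ as the removed edges. The loop-free multigraph game is played by the Angel and the Devil: starting from a loop-free multigraph $G$ with a graphical degree sequence, in each move the Devil chooses any multiple edge $e$ of the current graph, and then the Angel chooses any edge $e'$ not incident to $e$ and performs a double edge swap on $e$ and $e'$. The Angel wins if she reaches a simple graph; the Devil wins if the game goes on forever or if the Angel cannot make a move. *)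

theory Defs
  imports Main "HOL-Library.Multiset"
begin

text \<open>
  An edge is represented by its type, the two-element set of its endpoints, and parallel edges
  are repeated elements of the multiset of edges.
\<close>

record 'a multigraph =
  verts :: "'a set"
  edges :: "'a set multiset"

definition loop_free_multigraph :: "'a multigraph \<Rightarrow> bool" where
  "loop_free_multigraph G \<longleftrightarrow>
     finite (verts G) \<and> (\<forall>e \<in># edges G. e \<subseteq> verts G \<and> card e = 2)"

definition multiplicity :: "'a multigraph \<Rightarrow> 'a set \<Rightarrow> nat" where
  "multiplicity G e = count (edges G) e"

definition simple_edge :: "'a multigraph \<Rightarrow> 'a set \<Rightarrow> bool" where
  "simple_edge G e \<longleftrightarrow> e \<in># edges G \<and> multiplicity G e = 1"

definition multiple_edge :: "'a multigraph \<Rightarrow> 'a set \<Rightarrow> bool" where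
  "multiple_edge G e \<longleftrightarrow> e \<in># edges G \<and> multiplicity G e \<ge> 2"

definition simple :: "'a multigraph \<Rightarrow> bool" where
  "simple G \<longleftrightarrow> (\<forall>e \<in># edges G. simple_edge G e)"

definition degree :: "'a multigraph \<Rightarrow> 'a \<Rightarrow> nat" where
  "degree G v = size {#e \<in># edges G. v \<in> e#}"

definition degree_sequence :: "'a multigraph \<Rightarrow> nat list" where
  "degree_sequence G = rev (sorted_list_of_multiset (image_mset (degree G) (mset_set (verts G))))"

text \<open>
  Every finite graph is isomorphic to one whose vertices are natural numbers, so fixing the
  vertex type of the realization is no restriction.
\<close>

definition graphical :: "nat list \<Rightarrow> bool" where
  "graphical ds \<longleftrightarrow>
     (\<exists>H :: nat multigraph. loop_free_multigraph H \<and> simple H \<and> degree_sequence H = ds)"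

definition incident :: "'a set \<Rightarrow> 'a set \<Rightarrow> bool" where
  "incident e e' \<longleftrightarrow> e \<inter> e' \<noteq> {}"

text \<open>
  The value \<open>((v1, v2), (v3, v4))\<close> stands for the double edge swap
  $(v_1,v_2)(v_3,v_4)$. The order within each pair matters: exchanging \<open>v3\<close> and \<open>v4\<close>
  gives the other swap on the same two edges.
\<close>

type_synonym 'a swap = "('a \<times> 'a) \<times> ('a \<times> 'a)"

fun double_edge_swap :: "'a swap \<Rightarrow> 'a multigraph \<Rightarrow> 'a multigraph" where
  "double_edge_swap ((v1, v2), (v3, v4)) G =
     G\<lparr>edges := edges G - {#{v1, v2}, {v3, v4}#} + {#{v2, v3}, {v4, v1}#}\<rparr>"

text \<open>
  The Angel's options after the Devil has chosen \<open>e\<close>. Requiring \<open>e\<close> to be the first removed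
  edge loses nothing, since $(v_1,v_2)(v_3,v_4)$ and $(v_3,v_4)(v_1,v_2)$ are the same swap.
\<close>

fun angel_move :: "'a multigraph \<Rightarrow> 'a set \<Rightarrow> 'a swap \<Rightarrow> bool" where
  "angel_move G e ((v1, v2), (v3, v4)) \<longleftrightarrow>
     {v1, v2} = e \<and> {v3, v4} \<in># edges G \<and> \<not> incident e {v3, v4}"

text \<open>
  For a given starting position, a strategy of the Angel maps the list of all choices made by the
  Devil so far, the current one last, to her answer. Together with the strategy these choices
  determine all earlier positions, so strategies may depend on the whole history of the game.
\<close>

type_synonym 'a strategy = "'a set list \<Rightarrow> 'a swap"

text \<open>
  \<open>position \<sigma> G d n\<close> is the position after \<open>n\<close> moves if the Angel follows \<open>\<sigma>\<close> and the Devil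
  chooses \<open>d 0, d 1, \<dots>\<close>. The game is over at a simple graph, where the position stays constant.
\<close>

fun position :: "'a strategy \<Rightarrow> 'a multigraph \<Rightarrow> (nat \<Rightarrow> 'a set) \<Rightarrow> nat \<Rightarrow> 'a multigraph" where
  "position \<sigma> G d 0 = G"
| "position \<sigma> G d (Suc n) =
     (let H = position \<sigma> G d n
      in if simple H then H else double_edge_swap (\<sigma> (map d [0..<Suc n])) H)"

definition devil_legal :: "'a strategy \<Rightarrow> 'a multigraph \<Rightarrow> (nat \<Rightarrow> 'a set) \<Rightarrow> bool" where
  "devil_legal \<sigma> G d \<longleftrightarrow>
     (\<forall>n. \<not> simple (position \<sigma> G d n) \<longrightarrow> multiple_edge (position \<sigma> G d n) (d n))"

text \<open>
  A non-simple position always has a multiple edge, so every finite sequence of legal choices of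
  the Devil extends to an infinite sequence satisfying \<open>devil_legal\<close>.
\<close>

definition winning_strategy :: "'a multigraph \<Rightarrow> 'a strategy \<Rightarrow> bool" where
  "winning_strategy G \<sigma> \<longleftrightarrow>
     (\<forall>d. devil_legal \<sigma> G d \<longrightarrow>
        (\<forall>n. \<not> simple (position \<sigma> G d n) \<longrightarrow>
           angel_move (position \<sigma> G d n) (d n) (\<sigma> (map d [0..<Suc n]))) \<and>
        (\<exists>n. simple (position \<sigma> G d n)))"

end

theory Submission
  imports Defs
begin

text \<open>
  Fix a simple graph \<open>H\<close> with the same degree at every vertex as the current graph \<open>G\<close>. Call the
  edges of \<open>G - H\<close> red and those of \<open>H - G\<close> blue; at every vertex there are as many red as blue
  edges. A multiple edge $uv$ chosen by the Devil is red; let $v$ be the endpoint of smaller red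
  degree. There are a blue edge $ux$ and a red edge $xz$ with $z \neq v$: otherwise each blue
  neighbour $x$ of $u$ would be joined to $v$ by a red edge, and together with $uv$ this would give
  $v$ a larger red degree than $u$. The swap $(v,u)(x,z)$ removes two red edges and creates the
  edges $ux$ and $zv$, of which only $zv$ can be red, so the number of red edges decreases.
\<close>

section \<open>Realizing the degree sequence on the given vertices\<close>

lemma degree_sequence_eq_iff:
  "degree_sequence G = degree_sequence H \<longleftrightarrow>
     image_mset (degree G) (mset_set (verts G)) = image_mset (degree H) (mset_set (verts H))"
  unfolding degree_sequence_def
  by (metis mset_sorted_list_of_multiset rev_rev_ident)

text \<open>Applied to the degree functions, this turns equal degree sequences into a
  degree-preserving bijection of the vertex sets. The induction matches \<open>a\<close> with any
  element of \<open>B\<close> of the same value and deletes both.\<close>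

lemma image_mset_mset_set_eq_imp_bij_betw:
  assumes "finite A" "finite B"
    and "image_mset f (mset_set A) = image_mset g (mset_set B)"
  shows "\<exists>h. bij_betw h A B \<and> (\<forall>a \<in> A. g (h a) = f a)"
  using assms
proof (induction A arbitrary: B rule: finite_induct)
  case empty
  then have "B = {}" by (metis image_mset_empty image_mset_is_empty_iff mset_set.empty mset_set_empty_iff)
  then show ?case by (auto simp: bij_betw_def)
next
  case (insert a A)
  have "f a \<in># image_mset g (mset_set B)"
    using insert.hyps insert.prems by (metis image_mset_add_mset mset_set.insert union_single_eq_member)
  then obtain b where b: "b \<in> B" "g b = f a"
    using insert.prems(1) by auto
  have "image_mset f (mset_set A) = image_mset g (mset_set (B - {b}))"
    using insert.hyps insert.prems b by (simp add: mset_set.remove[of B b])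
  then obtain h where h: "bij_betw h A (B - {b})" "\<forall>x \<in> A. g (h x) = f x"
    using insert.IH[of "B - {b}"] insert.prems(1) by auto
  let ?h = "h(a := b)"
  have "bij_betw ?h A (B - {b})"
    using h(1) insert.hyps(2) by (metis bij_betw_cong fun_upd_apply)
  then have "bij_betw ?h (insert a A) (insert b (B - {b}))"
    using notIn_Un_bij_betw[of a A ?h "B - {b}"] insert.hyps(2) by simp
  then show ?case
    using b h(2) insert.hyps(2) by (intro exI[of _ ?h] conjI) (simp only: insert_Diff, auto)
qed

lemma simple_iff_count_le_1: "simple G \<longleftrightarrow> (\<forall>e. count (edges G) e \<le> 1)"
proof
  assume "simple G"
  then have "count (edges G) e \<le> 1" if "e \<in># edges G" for e
    using that by (simp add: simple_def simple_edge_def multiplicity_def)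
  then show "\<forall>e. count (edges G) e \<le> 1"
    by (metis not_in_iff zero_le_one)
next
  assume "\<forall>e. count (edges G) e \<le> 1"
  then show "simple G"
    by (auto simp: simple_def simple_edge_def multiplicity_def intro: antisym)
qed

lemma mset_eq_mset_set_if_count_le_1:
  assumes "\<And>x. count M x \<le> 1"
  shows "M = mset_set (set_mset M)"
proof (rule multiset_eqI)
  fix x
  show "count M x = count (mset_set (set_mset M)) x"
    using assms[of x] by (cases "x \<in># M") (auto simp: not_in_iff intro: antisym)
qed

text \<open>The realization provided by \<open>graphical\<close> has natural numbers as vertices; it
  is carried over to the vertices of \<open>G\<close> along a degree-preserving bijection.\<close>

lemma simple_graph_with_same_degrees:
  fixes G :: "'a multigraph"
  assumes "loop_free_multigraph G" and "graphical (degree_sequence G)"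
  obtains H :: "'a multigraph"
    where "loop_free_multigraph H" "simple H" "degree H = degree G"
proof -
  obtain K :: "nat multigraph"
    where K: "loop_free_multigraph K" "simple K" "degree_sequence K = degree_sequence G"
    using assms(2) by (auto simp: graphical_def)
  obtain h where h: "bij_betw h (verts K) (verts G)"
    and deg_h: "\<And>v. v \<in> verts K \<Longrightarrow> degree G (h v) = degree K v"
    using image_mset_mset_set_eq_imp_bij_betw[of "verts K" "verts G" "degree K" "degree G"]
      K assms(1) by (auto simp: degree_sequence_eq_iff loop_free_multigraph_def)
  have inj: "inj_on h (verts K)" and img: "h ` verts K = verts G"
    using h by (auto simp: bij_betw_def)
  have K_edge: "e \<subseteq> verts K" "card e = 2" if "e \<in># edges K" for e
    using K(1) that by (auto simp: loop_free_multigraph_def)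
  define H where "H = \<lparr>verts = verts G, edges = image_mset ((`) h) (edges K)\<rparr>"
  have H_edge: "e \<subseteq> verts G \<and> card e = 2" if "e \<in># edges H" for e
  proof -
    obtain e' where e': "e' \<in># edges K" "e = h ` e'"
      using \<open>e \<in># edges H\<close> by (auto simp: H_def)
    show ?thesis
      using K_edge[OF e'(1)] e'(2) inj img by (auto simp: card_image inj_on_subset)
  qed
  then have "loop_free_multigraph H"
    using assms(1) by (simp add: loop_free_multigraph_def) (simp add: H_def)
  moreover have "simple H"
  proof -
    \<comment> \<open>Distinct edges keep distinct images, so relabelling creates no parallel
      edges.\<close>
    have "inj_on ((`) h) (set_mset (edges K))"
      using inj_on_image_Pow[OF inj] by (rule inj_on_subset) (auto dest: K_edge)
    moreover have "edges K = mset_set (set_mset (edges K))"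
      using K(2) by (intro mset_eq_mset_set_if_count_le_1) (simp add: simple_iff_count_le_1)
    ultimately have "edges H = mset_set ((`) h ` set_mset (edges K))"
      by (metis H_def image_mset_mset_set multigraph.select_convs(2))
    then show ?thesis
      by (simp add: simple_iff_count_le_1 count_mset_set')
  qed
  moreover have "degree H v = degree G v" for v
  proof (cases "v \<in> verts G")
    case True
    then obtain w where w: "w \<in> verts K" "v = h w" using img by auto
    have "h w \<in> h ` e \<longleftrightarrow> w \<in> e" if "e \<in># edges K" for e
      using inj_on_image_mem_iff[OF inj w(1) K_edge(1)[OF that]] .
    then have "degree H v = degree K w"
      by (simp add: degree_def H_def w filter_mset_image_mset cong: filter_mset_cong)
    then show ?thesis using deg_h w by simp
  next
    \<comment> \<open>Off the vertex set both degrees are 0, so the degree functions agree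
      everywhere.\<close>
    case False
    then have "\<forall>e \<in># edges H. v \<notin> e" "\<forall>e \<in># edges G. v \<notin> e"
      using assms(1) H_edge by (auto simp: loop_free_multigraph_def)
    then show ?thesis by (simp add: degree_def cong: filter_mset_cong)
  qed
  ultimately show thesis using that by blast
qed

section \<open>The decreasing move\<close>

text \<open>Both \<open>M - N + N\<close> and \<open>N - M + M\<close> are the union with maximal
  multiplicities.\<close>

lemma size_Diff_eq_if_size_eq:
  fixes M N :: "'b multiset"
  assumes "size M = size N"
  shows "size (M - N) = size (N - M)"
proof -
  have "M - N + N = N - M + M"
    by (rule multiset_eqI) auto
  then show ?thesis
    using assms by (metis add_right_cancel size_union)
qed

lemma card_set_mset_le_size: "card (set_mset M) \<le> size M"
  by (induction M) (auto simp: card_insert_if)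

text \<open>Deleting the edges common to \<open>G\<close> and \<open>H\<close> lowers both degrees
  at \<open>v\<close> by the same amount.\<close>

lemma red_degree_eq_blue_degree:
  assumes "degree G v = degree H v"
  shows "size {#e \<in># edges G - edges H. v \<in> e#} = size {#e \<in># edges H - edges G. v \<in> e#}"
  using size_Diff_eq_if_size_eq assms by (simp add: degree_def)

lemma other_endpoint:
  assumes "card e = 2" and "a \<in> e"
  obtains b where "e = {a, b}"
  using assms by (auto simp: card_2_iff)

text \<open>Simplicity of \<open>H\<close> makes the blue degree of \<open>u\<close> count blue
  neighbours. Red edges may be parallel, but the argument needs only a lower bound on the red degree
  of \<open>v\<close>.\<close>

lemma blue_red_path:
  assumes G: "loop_free_multigraph G" and H: "loop_free_multigraph H" "simple H"
    and deg: "\<And>w. degree G w = degree H w"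
    and uv: "{u, v} \<in># edges G - edges H"
    and le: "size {#e \<in># edges G - edges H. v \<in> e#} \<le> size {#e \<in># edges G - edges H. u \<in> e#}"
  obtains x z where "{u, x} \<in># edges H - edges G" "{x, z} \<in># edges G - edges H" "z \<noteq> v"
proof -
  define R where "R = edges G - edges H"
  define B where "B = edges H - edges G"
  define A where "A = {x. {u, x} \<in># B}"
  have R_edge: "card e = 2" if "e \<in># R" for e
    using G that by (auto simp: R_def loop_free_multigraph_def dest: in_diffD)
  have B_edge: "card e = 2" if "e \<in># B" for e
    using H that by (auto simp: B_def loop_free_multigraph_def dest: in_diffD)
  have balanced: "size {#e \<in># R. w \<in> e#} = size {#e \<in># B. w \<in> e#}" for w
    unfolding R_def B_def using deg by (rule red_degree_eq_blue_degree)
  have inj: "inj_on (\<lambda>x. {w, x}) S" for w :: 'a and S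
    by (auto simp: inj_on_def doubleton_eq_iff)
  have "finite ((\<lambda>x. {u, x}) ` A)"
    by (rule finite_subset[of _ "set_mset B"]) (auto simp: A_def)
  then have fin: "finite A" using inj finite_imageD by blast
  have u: "u \<notin> A" using B_edge[of "{u, u}"] by (auto simp: A_def)
  have "e \<in> (\<lambda>x. {u, x}) ` A" if "e \<in># B" "u \<in> e" for e
    using other_endpoint[OF B_edge[OF that(1)] that(2)] that(1) unfolding A_def by blast
  then have "set_mset {#e \<in># B. u \<in> e#} \<subseteq> (\<lambda>x. {u, x}) ` A"
    by auto
  then have "card (set_mset {#e \<in># B. u \<in> e#}) \<le> card A"
    using fin by (meson card_image_le card_mono finite_imageI le_trans)
  moreover have "count {#e \<in># B. u \<in> e#} e \<le> 1" for e
    using H(2) by (auto simp: simple_iff_count_le_1 B_def intro: le_trans[OF diff_le_self])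
  ultimately have blue_u: "size {#e \<in># B. u \<in> e#} \<le> card A"
    by (metis mset_eq_mset_set_if_count_le_1 size_mset_set)
  have "\<exists>x \<in> A. \<exists>z. {x, z} \<in># R \<and> z \<noteq> v"
  proof (rule ccontr)
    assume *: "\<not> ?thesis"
    have "{v, x} \<in># R" if "x \<in> A" for x
    proof -
      have "{u, x} \<in># {#e \<in># B. x \<in> e#}" using that by (simp add: A_def)
      \<comment> \<open>By balance, the blue edge at \<open>x\<close> forces a red one there;
        \<open>*\<close> then leaves only \<open>v\<close> as its other end.\<close>
      then have "{#e \<in># R. x \<in> e#} \<noteq> {#}"
        using balanced[of x] by (metis empty_iff set_mset_empty size_eq_0_iff_empty)
      then obtain e where e: "e \<in># R" "x \<in> e"
        by (auto simp flip: set_mset_eq_empty_iff)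
      then obtain z where "e = {x, z}"
        using other_endpoint[OF R_edge] by blast
      then show ?thesis using * e that by (metis insert_commute)
    qed
    \<comment> \<open>The edge \<open>{u, v}\<close> itself makes \<open>u\<close> one more red
      neighbour of \<open>v\<close>, outside \<open>A\<close>.\<close>
    then have "(\<lambda>x. {v, x}) ` insert u A \<subseteq> set_mset {#e \<in># R. v \<in> e#}"
      using uv[folded R_def] by (auto simp del: filter_diff_mset simp: insert_commute)
    then have "card ((\<lambda>x. {v, x}) ` insert u A) \<le> card (set_mset {#e \<in># R. v \<in> e#})"
      by (intro card_mono) auto
    then have "Suc (card A) \<le> size {#e \<in># R. v \<in> e#}"
      using u fin card_set_mset_le_size[of "{#e \<in># R. v \<in> e#}"]
      unfolding card_image[OF inj] by simp
    then show False
      using le blue_u balanced[of u] unfolding R_def[symmetric] by simp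
  qed
  then show thesis using that by (auto simp: A_def R_def B_def)
qed

text \<open>Each of the four ends occurs once in a removed and once in an added edge. The
  inequalities exclude singletons, which \<open>degree\<close> would count only once.\<close>

lemma degree_double_edge_swap:
  assumes "{#{v1, v2}, {v3, v4}#} \<subseteq># edges G"
    and "v1 \<noteq> v2" "v3 \<noteq> v4" "v2 \<noteq> v3" "v4 \<noteq> v1"
  shows "degree (double_edge_swap ((v1, v2), (v3, v4)) G) w = degree G w"
proof -
  obtain M where M: "edges G = M + {#{v1, v2}, {v3, v4}#}"
    using assms(1) by (metis subset_mset.add_diff_inverse union_commute)
  show ?thesis using assms(2-) by (auto simp: degree_def M)
qed

text \<open>Loop-freeness and equality of degrees are carried along so that the same
  \<open>H\<close> serves throughout the game.\<close>

lemma decreasing_move: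
  assumes G: "loop_free_multigraph G" and H: "loop_free_multigraph H" "simple H"
    and deg: "degree G = degree H"
    and e: "multiple_edge G e"
  shows "\<exists>s. angel_move G e s \<and>
    loop_free_multigraph (double_edge_swap s G) \<and> degree (double_edge_swap s G) = degree H \<and>
    size (edges (double_edge_swap s G) - edges H) < size (edges G - edges H)"
proof -
  have e_red: "e \<in># edges G - edges H"
  proof -
    \<comment> \<open>A multiple edge has at least two copies in \<open>G\<close> and at most one in
      \<open>H\<close>.\<close>
    have "count (edges H) e < count (edges G) e"
      using e H(2) le_less_trans[of "count (edges H) e" 1]
      by (auto simp: multiple_edge_def multiplicity_def simple_iff_count_le_1)
    then show ?thesis by (simp add: in_diff_count)
  qed
  have G_edge: "a \<noteq> b" "{a, b} \<subseteq> verts G" if "{a, b} \<in># edges G" for a b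
    using G that by (force simp: loop_free_multigraph_def)+
  have H_edge: "a \<noteq> b" if "{a, b} \<in># edges H" for a b
    using H(1) that by (force simp: loop_free_multigraph_def)
  obtain a b where "e = {a, b}"
    using G e by (auto simp: multiple_edge_def loop_free_multigraph_def card_2_iff)
  obtain u v where uv: "e = {u, v}"
    and le: "size {#e \<in># edges G - edges H. v \<in> e#} \<le> size {#e \<in># edges G - edges H. u \<in> e#}"
    by (cases "size {#e \<in># edges G - edges H. b \<in> e#} \<le> size {#e \<in># edges G - edges H. a \<in> e#}")
      (use \<open>e = {a, b}\<close> that[of a b] that[of b a] in \<open>auto simp: insert_commute\<close>)
  obtain x z where blue: "{u, x} \<in># edges H - edges G" and red: "{x, z} \<in># edges G - edges H"
    and "z \<noteq> v"
    using blue_red_path[OF G H fun_cong[OF deg] e_red[unfolded uv] le] .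
  have uvG: "{v, u} \<in># edges G" and xzG: "{x, z} \<in># edges G"
    using e_red red uv by (auto simp: insert_commute dest: in_diffD)
  have fewer: "count (edges G) {u, x} < count (edges H) {u, x}"
    using blue by (simp add: in_diff_count)
  then have "count (edges G) {u, x} = 0"
    using H(2) by (metis less_one order_less_le_trans simple_iff_count_le_1)
  then have uxG: "{u, x} \<notin># edges G" by (simp add: count_eq_zero_iff)
  \<comment> \<open>As \<open>{u, x}\<close> is absent from \<open>G\<close>, the edge
    \<open>{v, u}\<close> gives \<open>x \<noteq> v\<close> and the edge \<open>{x, z}\<close> gives
    \<open>z \<noteq> u\<close>.\<close>
  have neq: "v \<noteq> u" "x \<noteq> z" "u \<noteq> x" "z \<noteq> v" "x \<noteq> v" "z \<noteq> u"
    using G_edge(1)[OF uvG] G_edge(1)[OF xzG] H_edge[OF in_diffD[OF blue]] \<open>z \<noteq> v\<close> uvG xzG uxG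
    by (auto simp: insert_commute)
  have disj: "{v, u} \<inter> {x, z} = {}" using neq by auto
  then have dist: "{v, u} \<noteq> {x, z}" by auto
  let ?s = "((v, u), (x, z))"
  let ?G' = "double_edge_swap ?s G"
  obtain N where N: "edges G - edges H = add_mset {v, u} N"
    using e_red uv by (metis insert_commute multi_member_split)
  \<comment> \<open>The two red edges have different types, so both can be split off from the red
    multiset.\<close>
  then have "{x, z} \<in># N" using red dist by auto
  then obtain M where M: "edges G - edges H = M + {#{v, u}, {x, z}#}"
    using N by (auto dest!: multi_member_split)
  have sub: "{#{v, u}, {x, z}#} \<subseteq># edges G"
    using M by (metis diff_subset_eq_self mset_subset_eq_add_right subset_mset.order_trans)
  have "edges ?G' - edges H \<subseteq># M + {#{z, v}#}"
  proof (rule mset_subset_eqI)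
    fix f
    let ?r = "count {#{v, u}, {x, z}#} f"
    have "count (edges G) f - count (edges H) f = count M f + ?r"
      using arg_cong[OF M, of "\<lambda>M. count M f"] by simp
    moreover have "?r \<le> count (edges G) f"
      using sub by (rule mset_subset_eq_count)
    \<comment> \<open>The new copy of \<open>{u, x}\<close> only fills a deficit of \<open>G\<close>
      against \<open>H\<close>, so truncated subtraction absorbs it.\<close>
    moreover have "count {#{u, x}#} f = 0 \<or>
        count {#{u, x}#} f = 1 \<and> count (edges G) f < count (edges H) f"
      using fewer by auto
    moreover have "count (edges ?G' - edges H) f =
        count (edges G) f - ?r + count {#{u, x}#} f + count {#{z, v}#} f - count (edges H) f"
      by simp
    ultimately show "count (edges ?G' - edges H) f \<le> count (M + {#{z, v}#}) f"
      unfolding count_union by linarith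
  qed
  then have "size (edges ?G' - edges H) \<le> size M + 1"
    by (auto dest!: size_mset_mono simp del: double_edge_swap.simps)
  then have "size (edges ?G' - edges H) < size (edges G - edges H)"
    by (simp add: M)
  moreover have "degree ?G' = degree H"
    using degree_double_edge_swap[OF sub] neq deg by (intro ext) auto
  moreover have "loop_free_multigraph ?G'"
    using G G_edge(2)[OF uvG] G_edge(2)[OF xzG] neq
    by (auto simp: loop_free_multigraph_def dest: in_diffD)
  moreover have "angel_move G e ?s"
    using uv xzG disj by (simp add: incident_def insert_commute)
  ultimately show ?thesis by blast
qed

section \<open>From decreasing moves to a winning strategy\<close>

text \<open>A choice of move depending only on the position and the edge chosen by the Devil
  suffices, since \<open>\<mu>\<close> cannot decrease forever.\<close>

lemma winning_strategy_if_decreasing_moves: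
  fixes Inv :: "'a multigraph \<Rightarrow> bool" and \<mu> :: "'a multigraph \<Rightarrow> nat"
  assumes G: "Inv G"
    and move: "\<And>P e. Inv P \<Longrightarrow> multiple_edge P e \<Longrightarrow>
      \<exists>s. angel_move P e s \<and> Inv (double_edge_swap s P) \<and> \<mu> (double_edge_swap s P) < \<mu> P"
  shows "\<exists>\<sigma>. winning_strategy G \<sigma>"
proof -
  obtain \<tau> where \<tau>: "angel_move P e (\<tau> P e)" "Inv (double_edge_swap (\<tau> P e) P)"
      "\<mu> (double_edge_swap (\<tau> P e) P) < \<mu> P" if "Inv P" "multiple_edge P e" for P e
    using move by metis
  define step where "step = (\<lambda>P e. if simple P then P else double_edge_swap (\<tau> P e) P)"
  \<comment> \<open>The earlier choices are replayed to recover the current position; the last one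
    is still to be answered.\<close>
  define \<sigma> where "\<sigma> es = \<tau> (foldl step G (butlast es)) (last es)" for es
  have position: "position \<sigma> G d n = foldl step G (map d [0..<n])" for d n
    by (induction n) (auto simp: \<sigma>_def step_def Let_def)
  have \<sigma>_eq: "\<sigma> (map d [0..<Suc n]) = \<tau> (position \<sigma> G d n) (d n)" for d n
    by (simp add: \<sigma>_def position)
  have "winning_strategy G \<sigma>"
    unfolding winning_strategy_def
  proof (intro allI impI conjI)
    fix d assume legal: "devil_legal \<sigma> G d"
    let ?p = "position \<sigma> G d"
    have p_Suc: "?p (Suc n) = double_edge_swap (\<tau> (?p n) (d n)) (?p n)" if "\<not> simple (?p n)" for n
      using that by (simp add: \<sigma>_eq Let_def del: upt_Suc)
    have multiple: "multiple_edge (?p n) (d n)" if "\<not> simple (?p n)" for n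
      using that legal by (simp add: devil_legal_def)
    have Inv: "Inv (?p n)" for n
    proof (induction n)
      case (Suc n)
      then show ?case
        using \<tau>(2)[OF Suc multiple] p_Suc[of n] by (cases "simple (?p n)") (auto simp: Let_def)
    qed (simp add: G)
    show "angel_move (?p n) (d n) (\<sigma> (map d [0..<Suc n]))" if "\<not> simple (?p n)" for n
      unfolding \<sigma>_eq using \<tau>(1) Inv multiple that by blast
    show "\<exists>n. simple (?p n)"
    proof (rule ccontr)
      assume "\<nexists>n. simple (?p n)"
      \<comment> \<open>A play that never reaches a simple graph would be an infinite descent in the
        natural numbers.\<close>
      then have "\<mu> (?p (Suc n)) < \<mu> (?p n)" for n
        using p_Suc[of n] \<tau>(3)[OF Inv multiple] by metis
      then show False
        by (metis in_measure wf_measure wf_no_infinite_down_chainE)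
    qed
  qed
  then show ?thesis by blast
qed

theorem theorem3p4:
  fixes G :: "'a multigraph"
  assumes "loop_free_multigraph G"
    and "graphical (degree_sequence G)"
  shows "\<exists>\<sigma>. winning_strategy G \<sigma>"
proof -
  obtain H :: "'a multigraph"
    where H: "loop_free_multigraph H" "simple H" "degree H = degree G"
    using simple_graph_with_same_degrees[OF assms] .
  show ?thesis
    by (rule winning_strategy_if_decreasing_moves
        [where Inv = "\<lambda>P. loop_free_multigraph P \<and> degree P = degree H"
          and \<mu> = "\<lambda>P. size (edges P - edges H)"])
      (use assms(1) H decreasing_move[OF _ H(1,2)] in auto)
qed

end
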